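(* Let $0\le\alpha<1$ and $0\le x_1<x_2\le1$, let $\mathcal{M}=\mathcal{M}_{\alpha,x_1,x_2}$ be the transformation of $[0,1)$ defined in the context and $\mathcal{S}$ its maximal invariant set. If $\mathcal{S}\neq\emptyset$, then the map $Y$ (defined in the context) is a bijection from $\mathcal{S}$ to $[0,1)$, and for each $t\in\mathcal{S}$, $$Y(\mathcal{M}(t))=\langle Y(t)+Y(\alpha)\rangle.$$ Moreover, $Y(\alpha)$ is irrational only if $\mathcal{S}\cap U\neq\emptyset$ and $\mathcal{S}\cap V\neq\emptyset$.
   Context: $\langle x\rangle=x-\lfloor x\rfloor$ is the fractional part of $x$. For $0\le\alpha<1$ and $0\le x_1<x_2\le 1$ put $U=[0,x_1)$, $\mathbf H=[x_1,x_2)$, $V=[x_2,1)$. The map $\mathcal{M}=\mathcal{M}_{\alpha,x_1,x_2}:[0,1)\to[0,1)$ is $\mathcal{M}(t)=\langle t+\alpha+x_2-x_1\rangle$ for $t\in U$, $\mathcal{M}(t)=t$ for $t\in\mathbf H$, $\mathcal{M}(t)=\langle t+\alpha\rangle$ for $t\in V$. The maximal invariant set $\mathcal{S}$ of $\mathcal{M}$ is the largest set $\mathcal{S}\subset[0,1)\setminus\mathbf H$ with $\mathcal{M}(\mathcal{S})=\mathcal{S}$; it is a finite union of left-closed right-open intervals. If $\mathcal{S}\ne\emptyset$, the squeezing map $Y:[0,1)\to[0,1)$ is $Y(t)=\big\langle |\mathcal{S}\cap[0,t)|/|\mathcal{S}|\big\rangle$, where $|\cdot|$ is Lebesgue measure.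 *)

theory Defs
  imports "HOL-Analysis.Analysis"
begin

definition seg_U :: "real \<Rightarrow> real set" where
  "seg_U x1 = {0..<x1}"

definition seg_H :: "real \<Rightarrow> real \<Rightarrow> real set" where
  "seg_H x1 x2 = {x1..<x2}"

definition seg_V :: "real \<Rightarrow> real set" where
  "seg_V x2 = {x2..<1}"

text \<open>The map \<open>M\<close> lives on \<open>[0,1)\<close>; the final branch is \<open>H\<close> (and, outside \<open>[0,1)\<close>, irrelevant).\<close>

definition trans_M :: "real \<Rightarrow> real \<Rightarrow> real \<Rightarrow> real \<Rightarrow> real" where
  "trans_M \<alpha> x1 x2 t =
     (if t \<in> seg_U x1 then frac (t + \<alpha> + x2 - x1)
      else if t \<in> seg_V x2 then frac (t + \<alpha>)
      else t)"

definition invariant_sets :: "real \<Rightarrow> real \<Rightarrow> real \<Rightarrow> real set set" where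
  "invariant_sets \<alpha> x1 x2 =
     {T. T \<subseteq> {0..<1} - seg_H x1 x2 \<and> trans_M \<alpha> x1 x2 ` T = T}"

definition max_inv_set :: "real \<Rightarrow> real \<Rightarrow> real \<Rightarrow> real set" where
  "max_inv_set \<alpha> x1 x2 = \<Union> (invariant_sets \<alpha> x1 x2)"

text \<open>The union is itself invariant, so it is the largest invariant set.\<close>

lemma max_inv_set_invariant: "max_inv_set \<alpha> x1 x2 \<in> invariant_sets \<alpha> x1 x2"
proof -
  have "trans_M \<alpha> x1 x2 ` \<Union> (invariant_sets \<alpha> x1 x2)
      = (\<Union>T\<in>invariant_sets \<alpha> x1 x2. trans_M \<alpha> x1 x2 ` T)"
    by (rule image_Union)
  also have "\<dots> = (\<Union>T\<in>invariant_sets \<alpha> x1 x2. T)"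
    by (rule SUP_cong) (simp_all add: invariant_sets_def)
  finally show ?thesis
    by (auto simp: max_inv_set_def invariant_sets_def)
qed

lemma max_inv_set_greatest:
  "T \<in> invariant_sets \<alpha> x1 x2 \<Longrightarrow> T \<subseteq> max_inv_set \<alpha> x1 x2"
  by (auto simp: max_inv_set_def)

definition squeeze_Y :: "real \<Rightarrow> real \<Rightarrow> real \<Rightarrow> real \<Rightarrow> real" where
  "squeeze_Y \<alpha> x1 x2 t =
     frac (measure lebesgue (max_inv_set \<alpha> x1 x2 \<inter> {0..<t})
           / measure lebesgue (max_inv_set \<alpha> x1 x2))"

end

theory Submission
  imports Defs
begin

text \<open>
  Translating the hole \<open>H\<close> onto the arc missed by \<open>M\<close> extends \<open>M\<close> to an interval exchange \<open>T\<close> of the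
  circle, and \<open>S\<close> consists of the points whose \<open>T\<close>-orbit avoids \<open>H\<close>. Return times to \<open>H\<close> under \<open>T\<close> and
  under its inverse are bounded, so a bounded number of iterates decides membership in \<open>S\<close>; hence every
  point of \<open>[0,1)\<close> has a right neighbourhood contained in \<open>S\<close> or in its complement, which makes \<open>Y\<close>
  bijective on \<open>S\<close>. As \<open>M\<close> preserves both the measure on \<open>S\<close> and the cyclic order, \<open>Y\<close>
  conjugates it to a rotation. If \<open>S\<close> misses \<open>U\<close> or \<open>V\<close>, then \<open>M\<close> is a rotation on \<open>S\<close>: an
  irrational angle would give an orbit dense in the circle, hence meeting \<open>H\<close>, and a rational angle
  makes \<open>M\<close> periodic on \<open>S\<close>, which forces \<open>Y(\<alpha>)\<close> to be rational.
\<close>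

section \<open>Interval exchanges of [0,1) and their return times\<close>

locale interval_exchange =
  fixes T :: "real \<Rightarrow> real" and E :: "real set"
  assumes finite_breaks: "finite E"
    and maps: "t \<in> {0..<1} \<Longrightarrow> T t \<in> {0..<1}"
    and inj: "inj_on T {0..<1}"
    and translates: "\<lbrakk>0 \<le> t; 0 \<le> u; t + u < 1; {t<..t+u} \<inter> E = {}\<rbrakk> \<Longrightarrow> T (t + u) = T t + u"
begin

lemma funpow_maps: "t \<in> {0..<1} \<Longrightarrow> (T ^^ n) t \<in> {0..<1}"
  by (induction n) (simp_all add: maps del: atLeastLessThan_iff)

text \<open>Turns a coincidence of two orbits into a visit of one orbit to the starting point of the
  other, which is how coincidences are excluded in \<open>bounded_return\<close>.\<close>

lemma funpow_cancel:
  assumes "x \<in> {0..<1}" "y \<in> {0..<1}" "(T ^^ (m + n)) x = (T ^^ m) y"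
  shows "(T ^^ n) x = y"
  using assms(3)
proof (induction m)
  case (Suc m)
  have "T ((T ^^ (m + n)) x) = T ((T ^^ m) y)"
    using Suc.prems by simp
  then have "(T ^^ (m + n)) x = (T ^^ m) y"
    using inj_onD[OF inj] funpow_maps assms(1,2) by blast
  then show ?case by (rule Suc.IH)
qed simp

text \<open>Since \<open>E\<close> is finite, the next breakpoint after \<open>t\<close> is at
  positive distance. One at \<open>t\<close> itself does no harm, because \<open>translates\<close>
  only forbids breakpoints in \<open>{t<..t+u}\<close>.\<close>

lemma translates_at_right:
  assumes t: "t \<in> {0..<1}"
  shows "\<forall>\<^sub>F s in at_right t. T s = T t + (s - t)"
proof -
  obtain b where b: "b > t" "b \<le> 1" "{t<..<b} \<inter> E = {}"
  proof -
    define D where "D = {e \<in> insert 1 E. t < e}"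
    have "finite D" "1 \<in> D" using finite_breaks t by (auto simp: D_def)
    then have "Min D \<in> D" "\<And>e. e \<in> D \<Longrightarrow> Min D \<le> e" by (auto intro: Min_in)
    then show ?thesis
      using \<open>1 \<in> D\<close> by (intro that[of "Min D"]) (force simp: D_def)+
  qed
  have "T s = T t + (s - t)" if "t < s" "s < b" for s
  proof -
    have "{t<..t + (s - t)} \<inter> E = {}" using b that by force
    then show ?thesis using translates[of t "s - t"] t b that by simp
  qed
  then show ?thesis using b(1) by (auto simp: eventually_at_right_field)
qed

lemma funpow_translates_at_right:
  assumes t: "t \<in> {0..<1}"
  shows "\<forall>\<^sub>F s in at_right t. (T ^^ n) s = (T ^^ n) t + (s - t)"
proof (induction n)
  case (Suc n)
  let ?x = "(T ^^ n) t"
  obtain b where b: "b > t" "\<And>s. t < s \<Longrightarrow> s < b \<Longrightarrow> (T ^^ n) s = ?x + (s - t)"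
    using Suc by (auto simp: eventually_at_right_field)
  obtain c where c: "c > ?x" "\<And>s. ?x < s \<Longrightarrow> s < c \<Longrightarrow> T s = T ?x + (s - ?x)"
    using translates_at_right[OF funpow_maps[OF t, of n]] by (auto simp: eventually_at_right_field)
  have "(T ^^ Suc n) s = (T ^^ Suc n) t + (s - t)"
    if "t < s" "s < min b (t + (c - ?x))" for s
    using b(2)[of s] c(2)[of "?x + (s - t)"] that by simp
  moreover have "min b (t + (c - ?x)) > t" using b(1) c(1) by simp
  ultimately show ?case unfolding eventually_at_right_field by blast
qed simp

text \<open>The iterates up to the first return to \<open>[a,b)\<close> are simultaneous translations on each of the
  finitely many pieces into which the first backward visits of the breakpoints cut \<open>[a,b)\<close>.
  A piece that never returned would have infinitely many disjoint images of the same length.\<close>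

lemma bounded_return:
  assumes "0 \<le> a" "b \<le> 1"
  obtains N where "\<And>h. h \<in> {a..<b} \<Longrightarrow> \<exists>n\<in>{1..N}. (T ^^ n) h \<in> {a..<b}"
proof -
  define H where "H = {a..<b}"
  \<comment> \<open>Adding the endpoints keeps the image of a piece from straddling the boundary of
    \<open>H\<close> as well.\<close>
  define E' where "E' = E \<union> {a, b}"
  have H01: "h \<in> {0..<1}" if "h \<in> H" for h using that assms by (auto simp: H_def)
  \<comment> \<open>The strict bound \<open>k < n\<close> admits a hit at the first return itself,
    since pieces must stay whole up to and including that time.\<close>
  define B1 where "B1 = {h \<in> H. \<exists>n\<ge>1. (T ^^ n) h \<in> E' \<and> (\<forall>k. 1 \<le> k \<and> k < n \<longrightarrow> (T ^^ k) h \<notin> H)}"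
  define B where "B = B1 \<union> (E' \<inter> H)"
  have finE: "finite E'" using finite_breaks by (simp add: E'_def)
  have "\<forall>h\<in>B1. \<exists>n\<ge>1. (T ^^ n) h \<in> E' \<and> (\<forall>k. 1 \<le> k \<and> k < n \<longrightarrow> (T ^^ k) h \<notin> H)"
    by (auto simp: B1_def)
  then obtain \<nu> where \<nu>: "\<And>h. h \<in> B1 \<Longrightarrow> \<nu> h \<ge> 1" "\<And>h. h \<in> B1 \<Longrightarrow> (T ^^ \<nu> h) h \<in> E'"
      "\<And>h k. h \<in> B1 \<Longrightarrow> 1 \<le> k \<Longrightarrow> k < \<nu> h \<Longrightarrow> (T ^^ k) h \<notin> H"
    by metis
  have B1H: "B1 \<subseteq> H" by (auto simp: B1_def)
  \<comment> \<open>If two points of \<open>B1\<close> hit the same breakpoint at different times,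
    the orbit of the later one passes through the other, a point of \<open>H\<close>, before its
    hit. Hence \<open>B1\<close> injects into \<open>E'\<close>.\<close>
  have same: "h = h'"
    if "h \<in> B1" "h' \<in> B1" "(T ^^ \<nu> h) h = (T ^^ \<nu> h') h'" "\<nu> h \<le> \<nu> h'" for h h'
  proof -
    define d where "d = \<nu> h' - \<nu> h"
    have d: "\<nu> h' = \<nu> h + d" using that by (simp add: d_def)
    have "(T ^^ d) h' = h"
      by (rule funpow_cancel[where m = "\<nu> h"]) (use that B1H H01 d in auto)
    moreover have "(T ^^ d) h' \<notin> H" if "d \<ge> 1"
      using \<nu>(3)[of h' d] \<nu>(1)[of h] that \<open>h \<in> B1\<close> \<open>h' \<in> B1\<close> d by simp
    ultimately show ?thesis using that(1) B1H by (cases "d = 0") auto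
  qed
  have "inj_on (\<lambda>h. (T ^^ \<nu> h) h) B1"
    by (rule inj_onI) (metis same nat_le_linear)
  moreover have "(\<lambda>h. (T ^^ \<nu> h) h) ` B1 \<subseteq> E'" using \<nu>(2) by auto
  ultimately have "finite B1" using finE by (meson finite_imageD finite_subset)
  then have finB: "finite B" using finE by (simp add: B_def)
  \<comment> \<open>As long as \<open>p\<close> stays outside \<open>H\<close>, the segment [p, p+u]
    moves rigidly: a point \<open>p + v\<close> with \<open>v > 0\<close> reaching \<open>E'\<close>
    by time \<open>n\<close> would itself be a cut in \<open>B\<close>, against
    \<open>gap\<close>.\<close>
  have piece: "\<forall>v\<in>{0..u}. (T ^^ n) (p + v) = (T ^^ n) p + v \<and> ((T ^^ n) (p + v) \<in> H \<longleftrightarrow> (T ^^ n) p \<in> H)"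
    if p: "p \<in> H" "p + u \<in> H" and gap: "{p<..p+u} \<inter> B = {}"
      and avoid: "\<forall>k. 1 \<le> k \<and> k < n \<longrightarrow> (T ^^ k) p \<notin> H" for p u n
    using avoid
  proof (induction n rule: less_induct)
    case (less n)
    have pv: "p + v \<in> H" if "v \<in> {0..u}" for v using that p by (auto simp: H_def)
    show ?case
    proof (cases n)
      case 0
      then show ?thesis using p pv by auto
    next
      case (Suc m)
      have IH: "(T ^^ k) (p + v) = (T ^^ k) p + v" "(T ^^ k) (p + v) \<in> H \<longleftrightarrow> (T ^^ k) p \<in> H"
        if "k < n" "v \<in> {0..u}" for k v
        using less.IH[of k] less.prems that by (meson less_trans)+
      have notE: "(T ^^ k) (p + v) \<notin> E'" if "k \<le> n" "0 < v" "v \<le> u" for k v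
      proof
        assume E: "(T ^^ k) (p + v) \<in> E'"
        have "\<forall>j. 1 \<le> j \<and> j < k \<longrightarrow> (T ^^ j) (p + v) \<notin> H"
          using IH(2)[of _ v] less.prems that by auto
        then have "p + v \<in> B"
          using E pv[of v] that unfolding B_def B1_def
          by (cases "k = 0") (auto simp: Suc_le_eq)
        moreover have "p + v \<in> {p<..p + u}" using that by simp
        ultimately show False using gap by blast
      qed
      let ?x = "(T ^^ m) p"
      have x: "?x \<in> {0..<1}" "?x + v \<in> {0..<1}" if "v \<in> {0..u}" for v
        using funpow_maps H01 p(1) pv[OF that] IH(1)[of m v] Suc that by (metis lessI)+
      have tr: "(T ^^ n) (p + v) = (T ^^ n) p + v" if v: "v \<in> {0..u}" for v
      proof -
        have "{?x<..?x + v} \<inter> E = {}"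
        proof -
          have "?x + w \<notin> E" if "0 < w" "w \<le> v" for w
            using notE[of m w] IH(1)[of m w] that v Suc by (auto simp: E'_def)
          then have "y \<notin> E" if "?x < y" "y \<le> ?x + v" for y
            using that by (metis add_diff_cancel_left' diff_add_cancel add.commute diff_gt_0_iff_gt
                diff_le_eq)
          then show ?thesis by auto
        qed
        then have "T (?x + v) = T ?x + v" using translates[of ?x v] x[OF v] v by auto
        then show ?thesis using IH(1)[of m v] Suc v by simp
      qed
      have "(T ^^ n) (p + v) \<in> H \<longleftrightarrow> (T ^^ n) p \<in> H" if v: "v \<in> {0..u}" for v
      proof -
        have out: "(T ^^ n) p + w \<noteq> c" if "0 < w" "w \<le> v" "c \<in> {a, b}" for w c
          using notE[of n w] tr[of w] that v by (auto simp: E'_def)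
        have "\<not> ((T ^^ n) p < c \<and> c \<le> (T ^^ n) p + v)" if "c \<in> {a, b}" for c
          using out[of "c - (T ^^ n) p" c] that by (auto simp: algebra_simps)
        from this[of a] this[of b] show ?thesis
          using tr[OF v] v by (auto simp: H_def)
      qed
      then show ?thesis using tr by blast
    qed
  qed
  have returns: "\<exists>n\<ge>1. (T ^^ n) h \<in> H" if h: "h \<in> H" for h
  proof (rule ccontr)
    assume "\<not> ?thesis"
    then have no: "\<And>n. n \<ge> 1 \<Longrightarrow> (T ^^ n) h \<notin> H" by blast
    define D where "D = {e \<in> insert b B. h < e}"
    have "finite D" "b \<in> D" using finB h by (auto simp: D_def H_def)
    then have D: "Min D \<in> D" "\<And>e. e \<in> D \<Longrightarrow> Min D \<le> e" by (auto intro: Min_in)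
    \<comment> \<open>Half the distance to the next cut, so that [h, h+u] stays in \<open>H\<close>
      and has no cut after \<open>h\<close>.\<close>
    define u where "u = (Min D - h) / 2"
    have u: "u > 0" "h + u < Min D" using D(1) by (auto simp: u_def D_def field_simps)
    have huH: "h + v \<in> H" if "v \<in> {0..u}" for v
      using h u D(2)[OF \<open>b \<in> D\<close>] that by (auto simp: H_def)
    have gap: "{h<..h+u} \<inter> B = {}" using D(2) u by (force simp: D_def)
    have tr: "(T ^^ n) (h + v) = (T ^^ n) h + v" "n \<ge> 1 \<Longrightarrow> (T ^^ n) (h + v) \<notin> H"
      if "v \<in> {0..u}" for n v
      using bspec[OF piece[OF h huH[of u] gap, of n] that] no u(1) by auto
    \<comment> \<open>A coincidence cancels to a visit of \<open>h\<close> or \<open>h + v\<close>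
      to \<open>H\<close> at a positive time.\<close>
    have sep: "(T ^^ n) h \<noteq> (T ^^ m) h + v" if v: "v \<in> {0..u}" and "n \<noteq> m" for n m v
    proof
      assume "(T ^^ n) h = (T ^^ m) h + v"
      then have eq: "(T ^^ n) h = (T ^^ m) (h + v)" using tr v by simp
      consider d where "n = m + d" "d \<ge> 1" | d where "m = n + d" "d \<ge> 1"
        using \<open>n \<noteq> m\<close> by (metis less_iff_Suc_add nat_neq_iff add_Suc_right le_add1 plus_1_eq_Suc)
      then show False
      proof cases
        case 1
        then have "(T ^^ d) h = h + v"
          using funpow_cancel[of h "h + v" m d] eq h huH[OF v] H01 by simp
        then show False using no[OF 1(2)] huH[OF v] by simp
      next
        case 2
        then have "(T ^^ d) (h + v) = h"
          using funpow_cancel[of "h + v" h n d] eq h huH[OF v] H01 by simp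
        then show False using tr(2)[OF v 2(2)] h by simp
      qed
    qed
    have far: "\<bar>(T ^^ n) h - (T ^^ m) h\<bar> > u" if "n \<noteq> m" for n m
      using sep[of "(T ^^ n) h - (T ^^ m) h" n m] sep[of "(T ^^ m) h - (T ^^ n) h" m n] that
      by (force simp: abs_if)
    \<comment> \<open>Left endpoints more than \<open>u\<close> apart lie in different cells of the
      grid of mesh \<open>u\<close>, of which [0,1) meets only finitely many.\<close>
    have "inj (\<lambda>n. \<lfloor>(T ^^ n) h / u\<rfloor>)"
    proof (rule injI, rule ccontr)
      fix n m assume eq: "\<lfloor>(T ^^ n) h / u\<rfloor> = \<lfloor>(T ^^ m) h / u\<rfloor>" and "n \<noteq> m"
      have "\<bar>(T ^^ n) h / u - (T ^^ m) h / u\<bar> < 1" using eq by linarith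
      then have "\<bar>(T ^^ n) h - (T ^^ m) h\<bar> / u < 1"
        using u(1) by (simp flip: diff_divide_distrib)
      then show False using far[OF \<open>n \<noteq> m\<close>] u(1) by (simp add: field_simps)
    qed
    moreover have "range (\<lambda>n. \<lfloor>(T ^^ n) h / u\<rfloor>) \<subseteq> {0..\<lfloor>1 / u\<rfloor>}"
    proof clarify
      fix n
      have "(T ^^ n) h \<in> {0..<1}" using funpow_maps H01 h by blast
      then show "\<lfloor>(T ^^ n) h / u\<rfloor> \<in> {0..\<lfloor>1 / u\<rfloor>}"
        using u(1) by (auto intro!: floor_mono divide_right_mono)
    qed
    ultimately show False
      by (meson finite_atLeastAtMost_int finite_imageD finite_subset infinite_UNIV_nat)
  qed
  define r where "r p = (LEAST n. n \<ge> 1 \<and> (T ^^ n) p \<in> H)" for p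
  have r: "r p \<ge> 1 \<and> (T ^^ r p) p \<in> H" "\<And>k. 1 \<le> k \<Longrightarrow> k < r p \<Longrightarrow> (T ^^ k) p \<notin> H" if "p \<in> H" for p
    using LeastI_ex[OF returns[OF that]] not_less_Least unfolding r_def by blast+
  have "(\<exists>n\<in>{1..Max (r ` B)}. (T ^^ n) h \<in> H)" if h: "h \<in> H" for h
  proof -
    define D where "D = {e \<in> B. e \<le> h}"
    \<comment> \<open>As \<open>a\<close> is a cut, there is a last cut \<open>p\<close> at or
      before \<open>h\<close>. Then \<open>h\<close> re-enters \<open>H\<close> at the first return
      time of \<open>p\<close>, and there are finitely many such times.\<close>
    have "a \<in> D" using h by (auto simp: D_def B_def E'_def H_def)
    moreover have "finite D" using finB by (simp add: D_def)
    ultimately have D: "Max D \<in> D" "\<And>e. e \<in> D \<Longrightarrow> e \<le> Max D" by (auto intro: Max_in)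
    define p where "p = Max D"
    have p: "p \<in> B" "p \<le> h" using D(1) by (auto simp: p_def D_def)
    then have pH: "p \<in> H" using B1H by (auto simp: B_def)
    have gap: "{p<..p + (h - p)} \<inter> B = {}" using D(2) by (force simp: D_def p_def)
    have "(T ^^ r p) h \<in> H"
      using piece[OF pH _ gap, of "r p"] r[OF pH] h p(2) by (auto dest!: bspec[of _ _ "h - p"])
    moreover have "r p \<le> Max (r ` B)" using finB p(1) by simp
    ultimately show ?thesis using r(1)[OF pH] by (meson atLeastAtMost_iff)
  qed
  then show thesis using that unfolding H_def by blast
qed

end

section \<open>Compositions, rotations and exchanges of two adjacent intervals\<close>

lemma interval_exchange_comp:
  assumes "interval_exchange S D" "interval_exchange T E"
  shows "interval_exchange (T \<circ> S) (D \<union> {t \<in> {0..<1}. S t \<in> E})"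
proof -
  interpret S: interval_exchange S D by fact
  interpret T: interval_exchange T E by fact
  show ?thesis
  proof
    have "inj_on S {t \<in> {0..<1}. S t \<in> E}" using S.inj by (rule inj_on_subset) auto
    moreover have "S ` {t \<in> {0..<1}. S t \<in> E} \<subseteq> E" by auto
    ultimately have "finite {t \<in> {0..<1}. S t \<in> E}"
      using T.finite_breaks by (meson finite_imageD finite_subset)
    then show "finite (D \<union> {t \<in> {0..<1}. S t \<in> E})" using S.finite_breaks by simp
    show "(T \<circ> S) t \<in> {0..<1}" if "t \<in> {0..<1}" for t
      using that S.maps T.maps by simp
    show "inj_on (T \<circ> S) {0..<1}"
      using S.inj T.inj S.maps by (intro comp_inj_on) (auto intro: inj_on_subset)
    fix t u :: real
    assume t: "0 \<le> t" "0 \<le> u" "t + u < 1"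
      and gap: "{t<..t + u} \<inter> (D \<union> {t \<in> {0..<1}. S t \<in> E}) = {}"
    have S: "S (t + v) = S t + v" if "0 \<le> v" "v \<le> u" for v
    proof -
      have "{t<..t + v} \<subseteq> {t<..t + u}" using that by auto
      then have "{t<..t + v} \<inter> D = {}" using gap by blast
      then show ?thesis using S.translates[of t v] t that by simp
    qed
    have "S t + v \<notin> E" if "0 < v" "v \<le> u" for v
    proof -
      have "t + v \<in> {t<..t + u}" "t + v \<in> {0..<1}" using that t by auto
      then have "S (t + v) \<notin> E" using gap by blast
      then show ?thesis using S[of v] that by simp
    qed
    then have "y \<notin> E" if "S t < y" "y \<le> S t + u" for y
      using that by (metis add_diff_cancel_left' diff_add_cancel add.commute diff_gt_0_iff_gt
          diff_le_eq)
    then have "{S t<..S t + u} \<inter> E = {}" by auto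
    moreover have "0 \<le> S t" "S t + u < 1"
      using S.maps[of t] S.maps[of "t + u"] S[of u] t by auto
    ultimately show "(T \<circ> S) (t + u) = (T \<circ> S) t + u"
      using T.translates[of "S t" u] S[of u] t by simp
  qed
qed

text \<open>The only break is where \<open>t + frac \<beta>\<close> reaches 1; for integral
  \<open>\<beta>\<close> it is 1 itself, outside [0,1).\<close>

lemma interval_exchange_rotation: "interval_exchange (\<lambda>t. frac (t + \<beta>)) {1 - frac \<beta>}"
proof
  show "inj_on (\<lambda>t. frac (t + \<beta>)) {0..<1}"
  proof (rule inj_onI)
    fix x y :: real assume xy: "x \<in> {0..<1}" "y \<in> {0..<1}" "frac (x + \<beta>) = frac (y + \<beta>)"
    then have "\<bar>x - y\<bar> < 1" "x - y = of_int (\<lfloor>x + \<beta>\<rfloor> - \<lfloor>y + \<beta>\<rfloor>)"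
      by (auto simp: frac_def)
    then show "x = y"
      by (smt (verit) of_int_0_eq_iff of_int_less_1_iff of_int_minus)
  qed
  fix t u :: real
  assume t: "0 \<le> t" "0 \<le> u" "t + u < 1" "{t<..t + u} \<inter> {1 - frac \<beta>} = {}"
  have "\<lfloor>t + u + \<beta>\<rfloor> = \<lfloor>t + \<beta>\<rfloor>"
    using t by (auto simp: floor_add frac_eq floor_eq_iff)
  then show "frac (t + u + \<beta>) = frac (t + \<beta>) + u" by (simp add: frac_def)
qed (auto simp: frac_lt_1)

text \<open>The exchange of [0,c) and [c,b). With \<open>c = x1\<close> and \<open>b = x2\<close> it
  moves the hole to the front and \<open>U\<close> right by \<open>x2 - x1\<close>, so that a
  rotation by \<open>\<alpha>\<close> afterwards gives both branches of \<open>M\<close>.\<close>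

definition swap_left :: "real \<Rightarrow> real \<Rightarrow> real \<Rightarrow> real" where
  "swap_left c b t = (if t < c then t + (b - c) else if t < b then t - c else t)"

lemma swap_left_inverse:
  "\<lbrakk>0 \<le> c; c \<le> b; 0 \<le> t\<rbrakk> \<Longrightarrow> swap_left (b - c) b (swap_left c b t) = t"
  by (auto simp: swap_left_def)

lemma interval_exchange_swap_left:
  assumes "0 \<le> c" "c \<le> b" "b \<le> 1"
  shows "interval_exchange (swap_left c b) {c, b}"
proof
  show "inj_on (swap_left c b) {0..<1}"
    by (rule inj_on_inverseI[where g = "swap_left (b - c) b"]) (use assms swap_left_inverse in auto)
  fix t u :: real
  assume t: "0 \<le> t" "0 \<le> u" "t + u < 1" "{t<..t + u} \<inter> {c, b} = {}"
  then have "c \<le> t \<or> t + u < c" "b \<le> t \<or> t + u < b" by auto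
  then show "swap_left c b (t + u) = swap_left c b t + u"
    using t assms by (auto simp: swap_left_def)
qed (use assms in \<open>auto simp: swap_left_def\<close>)

section \<open>Completion of M to a bijective interval exchange\<close>

locale squeezing =
  fixes \<alpha> x1 x2 :: real
  assumes \<alpha>: "0 \<le> \<alpha>" "\<alpha> < 1" and x12: "0 \<le> x1" "x1 < x2" "x2 \<le> 1"
begin

abbreviation H where "H \<equiv> {x1..<x2}"

abbreviation M where "M \<equiv> trans_M \<alpha> x1 x2"

abbreviation S where "S \<equiv> max_inv_set \<alpha> x1 x2"

text \<open>\<open>ext_M\<close> sends the hole \<open>H\<close> by a translation onto \<open>[\<alpha>, \<alpha> + x2 - x1)\<close> modulo 1,
  the arc missed by \<open>M\<close>, and thereby extends \<open>M\<close> to an interval exchange.\<close>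

definition ext_M :: "real \<Rightarrow> real" where
  "ext_M = (\<lambda>t. frac (t + \<alpha>)) \<circ> swap_left x1 x2"

definition ext_M_inv :: "real \<Rightarrow> real" where
  "ext_M_inv = swap_left (x2 - x1) x2 \<circ> (\<lambda>t. frac (t + (- \<alpha>)))"

lemma ext_M_eq: "t \<in> {0..<1} - H \<Longrightarrow> M t = ext_M t"
  by (auto simp: ext_M_def swap_left_def trans_M_def seg_U_def seg_V_def algebra_simps)

lemma ext_M_inv_ext_M: "t \<in> {0..<1} \<Longrightarrow> ext_M_inv (ext_M t) = t"
proof -
  assume t: "t \<in> {0..<1}"
  have "swap_left x1 x2 t \<in> {0..<1}" using t x12 by (auto simp: swap_left_def)
  moreover have "frac (frac z + - \<alpha>) = frac (z + - \<alpha>)" for z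
    by (simp only: frac_add_simps)
  ultimately have "frac (frac (swap_left x1 x2 t + \<alpha>) + - \<alpha>) = swap_left x1 x2 t"
    by (simp add: frac_eq)
  then show ?thesis using swap_left_inverse[of x1 x2 t] t x12 by (simp add: ext_M_def ext_M_inv_def)
qed

lemma ext_M_ext_M_inv: "t \<in> {0..<1} \<Longrightarrow> ext_M (ext_M_inv t) = t"
  using swap_left_inverse[of "x2 - x1" x2 "frac (t + - \<alpha>)"] x12
  by (simp add: ext_M_def ext_M_inv_def frac_eq)

sublocale ext: interval_exchange ext_M
  "{x1, x2} \<union> {t \<in> {0..<1}. swap_left x1 x2 t \<in> {1 - frac \<alpha>}}"
  unfolding ext_M_def
  using x12 by (intro interval_exchange_comp interval_exchange_swap_left interval_exchange_rotation) auto

text \<open>Makes \<open>bounded_return\<close> available for backward orbits, which is what bounds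
  the first entry time into \<open>H\<close>.\<close>

sublocale inv: interval_exchange ext_M_inv
  "{1 - frac (- \<alpha>)} \<union> {t \<in> {0..<1}. frac (t + - \<alpha>) \<in> {x2 - x1, x2}}"
  unfolding ext_M_inv_def
  using x12 by (intro interval_exchange_comp interval_exchange_swap_left interval_exchange_rotation) auto

lemma funpow_inv_funpow:
  assumes "t \<in> {0..<1}" "m \<le> n"
  shows "(ext_M_inv ^^ m) ((ext_M ^^ n) t) = (ext_M ^^ (n - m)) t"
  using assms(2)
proof (induction m)
  case (Suc m)
  then have "(ext_M_inv ^^ Suc m) ((ext_M ^^ n) t) = ext_M_inv ((ext_M ^^ Suc (n - Suc m)) t)"
    by (simp add: Suc_diff_Suc del: funpow.simps(2)) simp
  then show ?case using ext_M_inv_ext_M[OF ext.funpow_maps[OF assms(1)]] by simp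
qed simp

section \<open>S as the set of orbits avoiding the hole\<close>

lemma S_subset: "S \<subseteq> {0..<1} - H"
  and M_S: "M ` S = S"
  using max_inv_set_invariant[of \<alpha> x1 x2] by (auto simp: invariant_sets_def seg_H_def)

lemma S01: "t \<in> S \<Longrightarrow> t \<in> {0..<1}"
  using S_subset by blast

text \<open>\<open>M\<close> maps \<open>S\<close> onto \<open>S\<close>, and by injectivity of
  \<open>ext_M\<close> no other point of [0,1) lands there. The case \<open>t \<in> H\<close> is
  included: the image of the hole misses \<open>S\<close>.\<close>

lemma ext_M_mem_S_iff:
  assumes "t \<in> {0..<1}"
  shows "ext_M t \<in> S \<longleftrightarrow> t \<in> S"
proof
  assume "ext_M t \<in> S"
  then obtain s where s: "s \<in> S" "ext_M t = M s" using M_S by auto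
  then have "ext_M t = ext_M s" using ext_M_eq[of s] S_subset by auto
  then have "t = s" using inj_onD[OF ext.inj] assms S01[OF s(1)] by blast
  then show "t \<in> S" using s by simp
next
  assume "t \<in> S"
  then have "M t = ext_M t" using ext_M_eq S_subset by blast
  then show "ext_M t \<in> S" using M_S \<open>t \<in> S\<close> by (metis imageI)
qed

text \<open>The crux is that the avoiding points are mapped onto themselves. A preimage of such a
  point cannot lie in \<open>H\<close>, since it would return to \<open>H\<close> and the point
  would enter \<open>H\<close> as well.\<close>

lemma S_eq_avoiding: "S = {t \<in> {0..<1}. \<forall>n. (ext_M ^^ n) t \<notin> H}" (is "_ = ?W")
proof
  have "(ext_M ^^ n) t \<in> S" if "t \<in> S" for t n
    by (induction n) (use that S01 ext_M_mem_S_iff in auto)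
  then show "S \<subseteq> ?W" using S_subset by blast
next
  obtain N where N: "\<And>h. h \<in> H \<Longrightarrow> \<exists>n\<in>{1..N}. (ext_M ^^ n) h \<in> H"
    using ext.bounded_return[of x1 x2] x12 by auto
  have W: "?W \<subseteq> {0..<1} - H" by (auto dest: spec[of _ 0])
  have "ext_M ` ?W = ?W"
  proof
    show "ext_M ` ?W \<subseteq> ?W"
    proof clarify
      fix t assume t: "t \<in> {0..<1}" "\<forall>n. (ext_M ^^ n) t \<notin> H"
      have "(ext_M ^^ n) (ext_M t) \<notin> H" for n
        using t(2)[rule_format, of "Suc n"] by (simp add: funpow_swap1)
      then show "ext_M t \<in> {0..<1} \<and> (\<forall>n. (ext_M ^^ n) (ext_M t) \<notin> H)"
        using ext.maps t(1) by blast
    qed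
    show "?W \<subseteq> ext_M ` ?W"
    proof
      fix w assume w: "w \<in> ?W"
      define v where "v = ext_M_inv w"
      have v: "v \<in> {0..<1}" "ext_M v = w"
        using w inv.maps ext_M_ext_M_inv unfolding v_def by blast+
      have avoid: "(ext_M ^^ n) v \<notin> H" if "n \<ge> 1" for n
        using w v(2) that by (cases n) (auto simp: funpow_swap1)
      then have "v \<notin> H" using N[of v] by auto
      then have "(ext_M ^^ n) v \<notin> H" for n using avoid[of n] by (cases "n = 0") auto
      then show "w \<in> ext_M ` ?W" using v by blast
    qed
  qed
  moreover have "M ` ?W = ext_M ` ?W" using W ext_M_eq by (intro image_cong) auto
  ultimately have "?W \<in> invariant_sets \<alpha> x1 x2"
    using W by (simp add: invariant_sets_def seg_H_def)
  then show "?W \<subseteq> S" by (rule max_inv_set_greatest)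
qed

text \<open>Going back from a first entry into \<open>H\<close> at time \<open>n\<close>, the
  \<open>n\<close> steps down to \<open>t\<close> stay outside \<open>H\<close>, yet
  \<open>H\<close> is met again within \<open>N\<close> backward steps. Hence
  \<open>n < N\<close>.\<close>

lemma S_eq_avoiding_bounded:
  obtains N where "S = {t \<in> {0..<1}. \<forall>n<N. (ext_M ^^ n) t \<notin> H}"
proof -
  obtain N where N: "\<And>h. h \<in> H \<Longrightarrow> \<exists>n\<in>{1..N}. (ext_M_inv ^^ n) h \<in> H"
    using inv.bounded_return[of x1 x2] x12 by auto
  have "\<exists>n<N. (ext_M ^^ n) t \<in> H" if t: "t \<in> {0..<1}" and "\<exists>n. (ext_M ^^ n) t \<in> H" for t
  proof -
    define n where "n = (LEAST n. (ext_M ^^ n) t \<in> H)"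
    have n: "(ext_M ^^ n) t \<in> H" "\<And>k. k < n \<Longrightarrow> (ext_M ^^ k) t \<notin> H"
      using LeastI_ex[OF that(2)] not_less_Least unfolding n_def by blast+
    obtain m where m: "m \<in> {1..N}" "(ext_M_inv ^^ m) ((ext_M ^^ n) t) \<in> H"
      using N[OF n(1)] by blast
    have "n < m"
    proof (rule ccontr)
      assume "\<not> n < m"
      then have "(ext_M ^^ (n - m)) t \<in> H" using m(2) funpow_inv_funpow[OF t, of m n] by simp
      then show False using n(2)[of "n - m"] m(1) \<open>\<not> n < m\<close> by simp
    qed
    then have "n < N" using m(1) by simp
    then show ?thesis using n(1) by blast
  qed
  then have "S = {t \<in> {0..<1}. \<forall>n<N. (ext_M ^^ n) t \<notin> H}"
    unfolding S_eq_avoiding by blast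
  then show thesis by (rule that)
qed

text \<open>Finitely many iterates decide membership; each is a translation just to the right of
  \<open>t\<close>, and \<open>H\<close> is left-closed and right-open.\<close>

lemma S_locally_constant_at_right:
  assumes t: "t \<in> {0..<1}"
  obtains b where "t < b" "b \<le> 1" "\<And>s. t \<le> s \<Longrightarrow> s < b \<Longrightarrow> s \<in> S \<longleftrightarrow> t \<in> S"
proof -
  obtain N where N: "S = {t \<in> {0..<1}. \<forall>n<N. (ext_M ^^ n) t \<notin> H}"
    by (rule S_eq_avoiding_bounded)
  have "\<forall>\<^sub>F s in at_right t. (ext_M ^^ n) s \<in> H \<longleftrightarrow> (ext_M ^^ n) t \<in> H" for n
  proof -
    let ?x = "(ext_M ^^ n) t"
    obtain b where b: "b > t" "\<And>s. t < s \<Longrightarrow> s < b \<Longrightarrow> (ext_M ^^ n) s = ?x + (s - t)"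
      using ext.funpow_translates_at_right[OF t, of n] by (auto simp: eventually_at_right_field)
    obtain c where c: "c > ?x" "\<And>y. ?x < y \<Longrightarrow> y < c \<Longrightarrow> y \<in> H \<longleftrightarrow> ?x \<in> H"
    proof -
      consider "?x < x1" | "x1 \<le> ?x" "?x < x2" | "x2 \<le> ?x" by linarith
      then show ?thesis
        by cases (use that[of x1] that[of x2] that[of "?x + 1"] in auto)
    qed
    have "(ext_M ^^ n) s \<in> H \<longleftrightarrow> ?x \<in> H" if "t < s" "s < min b (t + (c - ?x))" for s
    proof -
      have "(ext_M ^^ n) s = ?x + (s - t)" using b(2) that by simp
      then show ?thesis using c(2)[of "?x + (s - t)"] that by simp
    qed
    moreover have "min b (t + (c - ?x)) > t" using b(1) c(1) by simp
    ultimately show ?thesis unfolding eventually_at_right_field by blast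
  qed
  then have "\<forall>\<^sub>F s in at_right t. \<forall>n\<in>{..<N}. (ext_M ^^ n) s \<in> H \<longleftrightarrow> (ext_M ^^ n) t \<in> H"
    by (intro eventually_ball_finite) auto
  then obtain b where b: "b > t"
    "\<And>s n. t < s \<Longrightarrow> s < b \<Longrightarrow> n < N \<Longrightarrow> (ext_M ^^ n) s \<in> H \<longleftrightarrow> (ext_M ^^ n) t \<in> H"
    by (auto simp: eventually_at_right_field)
  show thesis
  proof
    show "t < min b 1" "min b 1 \<le> 1" using b(1) t by auto
    fix s assume s: "t \<le> s" "s < min b 1"
    then have "\<forall>n<N. (ext_M ^^ n) s \<in> H \<longleftrightarrow> (ext_M ^^ n) t \<in> H"
      using b(2) by (cases "s = t") auto
    moreover have "s \<in> {0..<1}" using s t by auto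
    ultimately show "s \<in> S \<longleftrightarrow> t \<in> S" using t unfolding N by blast
  qed
qed

lemma S_borel [measurable]: "S \<in> sets borel"
proof -
  have [measurable]: "ext_M \<in> borel_measurable borel"
    unfolding ext_M_def swap_left_def frac_def comp_def by measurable
  have [measurable]: "(ext_M ^^ n) \<in> borel_measurable borel" for n
    by (induction n) (auto simp: comp_def intro: measurable_compose)
  have "S = {t \<in> space borel. t \<in> {0..<1} \<and> (\<forall>n. (ext_M ^^ n) t \<notin> H)}"
    by (simp add: S_eq_avoiding)
  also have "\<dots> \<in> sets borel" by measurable
  finally show ?thesis .
qed

section \<open>The periodic extension of S and its distribution function\<close>

definition P :: "real set" where "P = {x. frac x \<in> S}"

text \<open>Using the periodic \<open>P\<close> instead of \<open>S\<close> lets \<open>F\<close>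
  grow by \<open>F 1\<close> over each further period, so \<open>F x / F 1\<close> is a lift of
  \<open>Y\<close> for \<open>x \<ge> 0\<close> and rotations need no case split at 1.\<close>

definition F :: "real \<Rightarrow> real" where "F x = measure lebesgue (P \<inter> {0..<x})"

lemma P_Ico_lmeasurable: "P \<inter> {a..<b} \<in> lmeasurable"
proof -
  have "P = {x \<in> space borel. frac x \<in> S}" by (simp add: P_def)
  also have "\<dots> \<in> sets borel" unfolding frac_def by measurable
  finally have "P \<inter> {a..<b} \<in> sets lebesgue" by simp
  then show ?thesis
    by (intro bounded_set_imp_lmeasurable) (auto intro: bounded_subset[of "{a..b}"])
qed

lemma F_diff:
  assumes "0 \<le> a" "a \<le> b"
  shows "F b = F a + measure lebesgue (P \<inter> {a..<b})"
proof -
  have "P \<inter> {0..<b} = (P \<inter> {0..<a}) \<union> (P \<inter> {a..<b})" using assms by auto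
  moreover have "(P \<inter> {0..<a}) \<inter> (P \<inter> {a..<b}) = {}" by auto
  ultimately show ?thesis
    unfolding F_def by (simp add: measure_Un3 P_Ico_lmeasurable)
qed

lemma measure_P_shift:
  assumes "\<And>x. a \<le> x \<Longrightarrow> x < b \<Longrightarrow> x + c \<in> P \<longleftrightarrow> x \<in> P"
  shows "measure lebesgue (P \<inter> {a + c..<b + c}) = measure lebesgue (P \<inter> {a..<b})"
proof -
  have "P \<inter> {a + c..<b + c} = (+) c ` (P \<inter> {a..<b})"
  proof (intro equalityI subsetI)
    fix y assume "y \<in> P \<inter> {a + c..<b + c}"
    then have "y - c \<in> P \<inter> {a..<b}" using assms[of "y - c"] by auto
    then show "y \<in> (+) c ` (P \<inter> {a..<b})" by force
  qed (use assms in \<open>auto simp: add.commute\<close>)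
  then show ?thesis by (simp only: measure_translation)
qed

lemma P_iff: "x \<in> {0..<1} \<Longrightarrow> x \<in> P \<longleftrightarrow> x \<in> S"
  by (simp add: P_def frac_eq)

lemma P_add_1: "x + 1 \<in> P \<longleftrightarrow> x \<in> P"
  by (simp add: P_def frac_1_eq)

lemma F_0: "F 0 = 0"
  by (simp add: F_def)

lemma F_mono: "0 \<le> a \<Longrightarrow> a \<le> b \<Longrightarrow> F a \<le> F b"
  using F_diff[of a b] by simp

lemma F_add_1:
  assumes "0 \<le> x"
  shows "F (x + 1) = F x + F 1"
  using F_diff[of 1 "x + 1"] measure_P_shift[of 0 x 1] P_add_1 assms by (simp add: F_def)

lemma F_add_nat:
  assumes "0 \<le> x"
  shows "F (x + real n) = F x + real n * F 1"
proof (induction n)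
  case (Suc n)
  have "F (x + real (Suc n)) = F (x + real n + 1)" by (simp add: algebra_simps)
  also have "\<dots> = F (x + real n) + F 1" using assms by (intro F_add_1) simp
  finally show ?case using Suc by (simp add: algebra_simps)
qed simp

section \<open>Strict growth of F and bijectivity of Y\<close>

lemma S_Int_Ico: "t \<le> 1 \<Longrightarrow> S \<inter> {0..<t} = P \<inter> {0..<t}"
  using P_iff by fastforce

lemma squeeze_Y_eq:
  assumes "t \<in> {0..<1}"
  shows "squeeze_Y \<alpha> x1 x2 t = frac (F t / F 1)"
proof -
  have "S = P \<inter> {0..<1}" using S_Int_Ico[of 1] S01 by auto
  then show ?thesis using S_Int_Ico[of t] assms by (simp add: squeeze_Y_def F_def)
qed

text \<open>A right neighbourhood of \<open>s\<close> lies in \<open>S\<close>, and there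
  \<open>F\<close> has slope 1.\<close>

lemma F_strict_mono:
  assumes "s \<in> S" "s < t"
  shows "F s < F t"
proof -
  have s: "s \<in> {0..<1}" using S01 assms(1) by blast
  obtain b where b: "s < b" "b \<le> 1" "\<And>u. s \<le> u \<Longrightarrow> u < b \<Longrightarrow> u \<in> S \<longleftrightarrow> s \<in> S"
    using S_locally_constant_at_right[OF s] by metis
  define c where "c = min b t"
  have c: "s < c" "c \<le> t" using b(1) assms(2) by (auto simp: c_def)
  have "{s..<c} \<subseteq> P" using b assms(1) s P_iff by (auto simp: c_def)
  then have "P \<inter> {s..<c} = {s..<c}" by auto
  then have "F c = F s + (c - s)" using F_diff[of s c] s c by simp
  then show ?thesis using F_mono[of c t] c s by simp
qed

lemma F_1_pos: "S \<noteq> {} \<Longrightarrow> 0 < F 1"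
  using F_strict_mono F_mono[of 0] S01 F_0 by fastforce

lemma F_Lipschitz:
  assumes "0 \<le> a" "a \<le> b"
  shows "F b - F a \<le> b - a"
proof -
  have "{a..<b} \<in> lmeasurable"
    by (intro bounded_set_imp_lmeasurable) (auto intro: bounded_subset[of "{a..b}"])
  then have "measure lebesgue (P \<inter> {a..<b}) \<le> measure lebesgue {a..<b}"
    by (intro measure_mono_fmeasurable) (auto intro: fmeasurableD P_Ico_lmeasurable)
  then show ?thesis using F_diff[OF assms] assms by simp
qed

lemma F_continuous: "continuous_on {0..1} F"
proof (rule lipschitz_on_continuous_on)
  show "1-lipschitz_on {0..1} F"
  proof (rule lipschitz_onI)
    fix x y :: real assume "x \<in> {0..1}" "y \<in> {0..1}"
    then show "dist (F x) (F y) \<le> 1 * dist x y"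
      using F_Lipschitz[of x y] F_Lipschitz[of y x] F_mono[of x y] F_mono[of y x]
      by (cases "x \<le> y") (auto simp: dist_real_def)
  qed simp
qed

text \<open>Dropping the integer part of \<open>x\<close> changes \<open>F x / F 1\<close> by that
  same integer.\<close>

lemma squeeze_Y_frac:
  assumes "S \<noteq> {}" "0 \<le> x"
  shows "squeeze_Y \<alpha> x1 x2 (frac x) = frac (F x / F 1)"
proof -
  define n where "n = nat \<lfloor>x\<rfloor>"
  have x: "x = frac x + real n" using assms(2) by (simp add: n_def frac_def)
  have "F x / F 1 = F (frac x) / F 1 + real n"
    using F_add_nat[of "frac x" n] x F_1_pos[OF assms(1)] by (simp add: field_simps)
  moreover have "frac (F (frac x) / F 1 + real n) = frac (F (frac x) / F 1)"
    by (metis frac_add_of_int_right of_int_of_nat_eq)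
  ultimately show ?thesis using squeeze_Y_eq[of "frac x"] by (simp add: frac_lt_1)
qed

text \<open>Strict growth after \<open>s\<close> gives \<open>F s < F 1\<close>, so no reduction
  modulo 1 takes place.\<close>

lemma squeeze_Y_on_S:
  assumes "s \<in> S"
  shows "squeeze_Y \<alpha> x1 x2 s = F s / F 1"
proof -
  have "s \<in> {0..<1}" using S01 assms by blast
  moreover have "F s < F 1" using F_strict_mono[OF assms, of 1] \<open>s \<in> {0..<1}\<close> by simp
  moreover have "0 \<le> F s" by (simp add: F_def)
  ultimately show ?thesis by (simp add: squeeze_Y_eq frac_eq)
qed

lemma squeeze_Y_bij:
  assumes "S \<noteq> {}"
  shows "bij_betw (squeeze_Y \<alpha> x1 x2) S {0..<1}"
proof (rule bij_betw_imageI)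
  have F1: "F 1 > 0" using F_1_pos assms by blast
  show "inj_on (squeeze_Y \<alpha> x1 x2) S"
  proof (rule inj_onI)
    fix s t assume "s \<in> S" "t \<in> S" "squeeze_Y \<alpha> x1 x2 s = squeeze_Y \<alpha> x1 x2 t"
    then have "F s = F t" using F1 by (simp add: squeeze_Y_on_S)
    then show "s = t" using F_strict_mono[of s t] F_strict_mono[of t s] \<open>s \<in> S\<close> \<open>t \<in> S\<close> by force
  qed
  show "squeeze_Y \<alpha> x1 x2 ` S = {0..<1}"
  proof (intro equalityI subsetI)
    fix y assume "y \<in> squeeze_Y \<alpha> x1 x2 ` S"
    then show "y \<in> {0..<1}" by (auto simp: squeeze_Y_def frac_lt_1)
  next
    fix y :: real assume y: "y \<in> {0..<1}"
    define z where "z = y * F 1"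
    have z: "0 \<le> z" "z < F 1" using y F1 by (auto simp: z_def)
    \<comment> \<open>The preimage of \<open>y\<close> is the largest \<open>b\<close> with
      \<open>F b \<le> z\<close>: of all points where \<open>F\<close> takes the value
      \<open>z\<close>, only the last one can be in \<open>S\<close>.\<close>
    define A where "A = {0..1} \<inter> F -` {..z}"
    have "closed A"
      unfolding A_def by (rule continuous_closed_preimage[OF F_continuous]) auto
    then have "compact A"
      by (auto simp: A_def compact_eq_bounded_closed intro: bounded_subset[of "{0..1}"])
    moreover have "0 \<in> A" using z F_0 by (auto simp: A_def)
    ultimately obtain b where b: "b \<in> A" "\<And>a. a \<in> A \<Longrightarrow> a \<le> b"
      using compact_attains_sup[of A] by auto
    have b01: "b \<in> {0..<1}" using b(1) z by (auto simp: A_def less_le)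
    have "F b \<ge> z"
    proof (rule ccontr)
      assume "\<not> F b \<ge> z"
      then obtain t where "b \<le> t" "t \<le> 1" "F t = z"
        using IVT'[of F b z 1] z b01 continuous_on_subset[OF F_continuous, of "{b..1}"] by auto
      then have "t \<in> A" using b01 by (auto simp: A_def)
      then show False using b(2)[of t] \<open>b \<le> t\<close> \<open>F t = z\<close> \<open>\<not> F b \<ge> z\<close> by simp
    qed
    then have Fb: "F b = z" using b(1) by (auto simp: A_def)
    \<comment> \<open>Otherwise \<open>F\<close> would remain equal to \<open>z\<close> on an
      interval to the right of \<open>b\<close>, against maximality.\<close>
    have "b \<in> S"
    proof (rule ccontr)
      assume "b \<notin> S"
      obtain c where c: "b < c" "c \<le> 1" "\<And>u. b \<le> u \<Longrightarrow> u < c \<Longrightarrow> u \<in> S \<longleftrightarrow> b \<in> S"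
        using S_locally_constant_at_right[OF b01] by metis
      have "u \<notin> P" if "b \<le> u" "u < c" for u using c P_iff[of u] b01 that \<open>b \<notin> S\<close> by auto
      then have "P \<inter> {b..<c} = {}" by auto
      then have "F c = z" using F_diff[of b c] b01 c Fb by simp
      then have "c \<in> A" using c b01 by (auto simp: A_def)
      then show False using b(2) c(1) by force
    qed
    moreover have "squeeze_Y \<alpha> x1 x2 b = y"
      using squeeze_Y_on_S[OF \<open>b \<in> S\<close>] Fb F1 by (simp add: z_def)
    ultimately show "y \<in> squeeze_Y \<alpha> x1 x2 ` S" by blast
  qed
qed

section \<open>Conjugation to a rotation\<close>

text \<open>\<open>ext_M\<close> lifts to translations by \<open>\<alpha>\<close> on \<open>[x2,1)\<close> and by \<open>\<alpha> + x2 - x1\<close> on \<open>[0,x1)\<close>, and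
  preserves \<open>S\<close>; comparing the measure of \<open>S\<close> on \<open>[t,1)\<close>, respectively \<open>[0,t)\<close>, with that on the image
  gives the additivity of \<open>F\<close>.\<close>

lemma F_add_\<alpha>:
  assumes t: "t \<in> {x2..<1}"
  shows "F (t + \<alpha>) = F t + F \<alpha>"
proof -
  have "x + \<alpha> \<in> P \<longleftrightarrow> x \<in> P" if "t \<le> x" "x < 1" for x
  proof -
    have x: "x \<in> {0..<1}" using that t x12 by auto
    have "ext_M x = frac (x + \<alpha>)" using that t x12 by (auto simp: ext_M_def swap_left_def)
    then show ?thesis using ext_M_mem_S_iff[OF x] P_iff[OF x] by (simp add: P_def)
  qed
  then have "measure lebesgue (P \<inter> {t + \<alpha>..<1 + \<alpha>}) = measure lebesgue (P \<inter> {t..<1})"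
    by (intro measure_P_shift) auto
  moreover have "F 1 = F t + measure lebesgue (P \<inter> {t..<1})"
    using t x12 by (intro F_diff) auto
  moreover have "F (1 + \<alpha>) = F (t + \<alpha>) + measure lebesgue (P \<inter> {t + \<alpha>..<1 + \<alpha>})"
    using t x12 \<alpha> by (intro F_diff) auto
  moreover have "F (1 + \<alpha>) = F \<alpha> + F 1" using F_add_1[of \<alpha>] \<alpha> by (simp add: add.commute)
  ultimately show ?thesis by simp
qed

lemma F_add_\<alpha>_hole:
  assumes t: "t \<in> {0..<x1}"
  shows "F (t + (\<alpha> + x2 - x1)) = F t + F \<alpha>"
proof -
  let ?\<gamma> = "\<alpha> + x2 - x1"
  have "x + ?\<gamma> \<in> P \<longleftrightarrow> x \<in> P" if "0 \<le> x" "x < t" for x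
  proof -
    have x: "x \<in> {0..<1}" using that t x12 by auto
    have "ext_M x = frac (x + ?\<gamma>)"
      using that t x12 by (auto simp: ext_M_def swap_left_def algebra_simps)
    then show ?thesis using ext_M_mem_S_iff[OF x] P_iff[OF x] by (simp add: P_def)
  qed
  then have "measure lebesgue (P \<inter> {0 + ?\<gamma>..<t + ?\<gamma>}) = measure lebesgue (P \<inter> {0..<t})"
    by (intro measure_P_shift) auto
  moreover have "F (t + ?\<gamma>) = F ?\<gamma> + measure lebesgue (P \<inter> {?\<gamma>..<t + ?\<gamma>})"
    using t x12 \<alpha> by (intro F_diff) auto
  moreover have "F ?\<gamma> = F \<alpha> + measure lebesgue (P \<inter> {\<alpha>..<?\<gamma>})"
    using x12 \<alpha> by (intro F_diff) auto
  \<comment> \<open>This arc is the image of the hole under \<open>ext_M\<close> and so carries no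
    mass of \<open>S\<close>, which gives \<open>F\<close> the same value at
    \<open>?\<gamma>\<close> as at \<open>\<alpha>\<close>.\<close>
  moreover have "P \<inter> {\<alpha>..<?\<gamma>} = {}"
  proof -
    have "x \<notin> P" if "\<alpha> \<le> x" "x < ?\<gamma>" for x
    proof -
      have h: "x1 + (x - \<alpha>) \<in> H" "x1 + (x - \<alpha>) \<in> {0..<1}" using that x12 by auto
      then have "ext_M (x1 + (x - \<alpha>)) = frac x" by (auto simp: ext_M_def swap_left_def)
      then show ?thesis using ext_M_mem_S_iff[OF h(2)] h(1) S_subset by (auto simp: P_def)
    qed
    then show ?thesis by auto
  qed
  ultimately show ?thesis by (simp add: F_def)
qed

lemma M_cases:
  assumes "t \<in> S"
  obtains "t \<in> {0..<x1}" "M t = frac (t + (\<alpha> + x2 - x1))" | "t \<in> {x2..<1}" "M t = frac (t + \<alpha>)"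
  using subsetD[OF S_subset assms] x12 that
  by (auto simp: trans_M_def seg_U_def seg_V_def algebra_simps)

text \<open>The two branches of \<open>M\<close> shift by different amounts, but both add exactly
  \<open>F \<alpha>\<close> to \<open>F\<close>.\<close>

lemma squeeze_Y_conj:
  assumes "t \<in> S"
  shows "squeeze_Y \<alpha> x1 x2 (M t) = frac (squeeze_Y \<alpha> x1 x2 t + squeeze_Y \<alpha> x1 x2 \<alpha>)"
proof -
  have ne: "S \<noteq> {}" using assms by blast
  have t: "t \<in> {0..<1}" using S01 assms by blast
  obtain \<gamma> where \<gamma>: "0 \<le> \<gamma>" "M t = frac (t + \<gamma>)" "F (t + \<gamma>) = F t + F \<alpha>"
    using assms
  proof (cases rule: M_cases)
    case 1
    then show ?thesis using that[of "\<alpha> + x2 - x1"] F_add_\<alpha>_hole \<alpha> x12 by auto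
  next
    case 2
    then show ?thesis using that[of \<alpha>] F_add_\<alpha> \<alpha> by auto
  qed
  have "squeeze_Y \<alpha> x1 x2 (M t) = frac (F (t + \<gamma>) / F 1)"
    using squeeze_Y_frac[OF ne, of "t + \<gamma>"] \<gamma> t by simp
  also have "\<dots> = frac (F t / F 1 + F \<alpha> / F 1)" by (simp add: \<gamma>(3) add_divide_distrib)
  finally show ?thesis using squeeze_Y_eq t \<alpha> by simp
qed

section \<open>Rationality when M is a single rotation on S\<close>

lemma squeeze_Y_\<alpha>_rational:
  assumes "S \<noteq> {}" and rot: "\<And>t. t \<in> S \<Longrightarrow> M t = frac (t + \<gamma>)"
  shows "squeeze_Y \<alpha> x1 x2 \<alpha> \<in> \<rat>"
proof -
  let ?Y = "squeeze_Y \<alpha> x1 x2"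
  obtain t where t: "t \<in> S" using assms(1) by blast
  have t01: "t \<in> {0..<1}" using S01 t by blast
  have orbit: "frac (t + real n * \<gamma>) \<in> S \<and> ?Y (frac (t + real n * \<gamma>)) = frac (?Y t + real n * ?Y \<alpha>)"
    for n
  proof (induction n)
    case 0
    then show ?case using t t01 by (simp add: frac_eq squeeze_Y_def)
  next
    case (Suc n)
    let ?s = "frac (t + real n * \<gamma>)"
    have Ms: "M ?s = frac (t + real (Suc n) * \<gamma>)" using rot Suc by (simp add: algebra_simps)
    have "?Y (M ?s) = frac (?Y t + real n * ?Y \<alpha> + ?Y \<alpha>)" using squeeze_Y_conj Suc by simp
    also have "\<dots> = frac (?Y t + real (Suc n) * ?Y \<alpha>)" by (simp add: algebra_simps)
    finally show ?case using Ms Suc M_S by (metis imageI)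
  qed
  show ?thesis
  proof (cases "\<gamma> \<in> \<rat>")
    case True
    then obtain p q where pq: "\<gamma> = of_int p / of_int q" "q > 0" by (meson Rats_cases')
    \<comment> \<open>The denominator of \<open>\<gamma>\<close> is a period of the orbit of
      \<open>t\<close>; comparing \<open>Y\<close> after \<open>n\<close> steps shows that
      \<open>n\<close> times \<open>Y(\<alpha>)\<close> is an integer.\<close>
    define n where "n = nat q"
    have n: "real n = of_int q" "n > 0" using pq by (auto simp: n_def)
    have "frac (t + real n * \<gamma>) = t" using pq n t01 by (simp add: frac_eq)
    then have "frac (?Y t + real n * ?Y \<alpha>) = ?Y t"
      using orbit[of n] by simp
    also have "\<dots> = frac (?Y t)" by (simp add: squeeze_Y_def)
    finally have "frac (?Y t + real n * ?Y \<alpha>) = frac (?Y t)" .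
    then have "real n * ?Y \<alpha> \<in> \<int>"
      by (metis add_diff_cancel_left' frac_eqE Ints_of_int add_diff_eq)
    then obtain k where "real n * ?Y \<alpha> = of_int k" by (auto elim: Ints_cases)
    then have "?Y \<alpha> = of_int k / of_int (int n)" using n(2) by (simp add: field_simps)
    then show ?thesis by simp
  next
    case False
    \<comment> \<open>Midpoint and half-length of the hole: Kronecker approximation brings some
      orbit point within \<open>e\<close> of \<open>m\<close> modulo 1, hence into \<open>H\<close>,
      although the orbit stays in \<open>S\<close>.\<close>
    define m where "m = (x1 + x2) / 2"
    define e where "e = (x2 - x1) / 2"
    have "frac (m - t) \<in> {0..1}" by (simp add: frac_lt_1 less_imp_le)
    moreover have "e > 0" using x12 by (simp add: e_def)
    ultimately obtain n where n: "\<bar>frac (real n * \<gamma>) - frac (m - t)\<bar> < e"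
      using Kronecker_approx_1_explicit[OF False, of "frac (m - t)" e] by auto
    define w where "w = frac (real n * \<gamma>) - frac (m - t)"
    have "\<bar>w\<bar> < e" using n by (simp add: w_def)
    moreover have "m - e = x1" "m + e = x2" by (simp_all add: m_def e_def field_simps)
    ultimately have "m + w \<in> H" by auto
    have "t + real n * \<gamma> = m + w + of_int (\<lfloor>real n * \<gamma>\<rfloor> - \<lfloor>m - t\<rfloor>)"
      by (simp add: w_def frac_def)
    then have "frac (t + real n * \<gamma>) = frac (m + w)" by (simp only: frac_add_of_int_right)
    also have "\<dots> = m + w" using \<open>m + w \<in> H\<close> x12 by (intro frac_eq_id) auto
    finally have "m + w \<in> S" using orbit[of n] by simp
    then show ?thesis using \<open>m + w \<in> H\<close> S_subset by blast
  qed
qed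

end

theorem theorem1p4:
  fixes \<alpha> x1 x2 :: real
  assumes "0 \<le> \<alpha>" and "\<alpha> < 1"
    and "0 \<le> x1" and "x1 < x2" and "x2 \<le> 1"
    and "max_inv_set \<alpha> x1 x2 \<noteq> {}"
  shows "bij_betw (squeeze_Y \<alpha> x1 x2) (max_inv_set \<alpha> x1 x2) {0..<1}
    \<and> (\<forall>t\<in>max_inv_set \<alpha> x1 x2.
          squeeze_Y \<alpha> x1 x2 (trans_M \<alpha> x1 x2 t)
            = frac (squeeze_Y \<alpha> x1 x2 t + squeeze_Y \<alpha> x1 x2 \<alpha>))
    \<and> (squeeze_Y \<alpha> x1 x2 \<alpha> \<notin> \<rat> \<longrightarrow>
          max_inv_set \<alpha> x1 x2 \<inter> seg_U x1 \<noteq> {}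
          \<and> max_inv_set \<alpha> x1 x2 \<inter> seg_V x2 \<noteq> {})"
proof -
  interpret squeezing \<alpha> x1 x2 by standard fact+
  \<comment> \<open>Missing \<open>U\<close> leaves only the shift by \<open>\<alpha>\<close> on
    \<open>S\<close>; missing \<open>V\<close> leaves only that by
    \<open>\<alpha> + x2 - x1\<close>.\<close>
  have "squeeze_Y \<alpha> x1 x2 \<alpha> \<in> \<rat>" if "S \<inter> seg_U x1 = {}"
  proof (rule squeeze_Y_\<alpha>_rational[OF assms(6), of \<alpha>])
    fix t assume "t \<in> S"
    then show "M t = frac (t + \<alpha>)"
      using that \<open>t \<in> S\<close> by (cases rule: M_cases) (auto simp: seg_U_def)
  qed
  moreover have "squeeze_Y \<alpha> x1 x2 \<alpha> \<in> \<rat>" if "S \<inter> seg_V x2 = {}"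
  proof (rule squeeze_Y_\<alpha>_rational[OF assms(6), of "\<alpha> + x2 - x1"])
    fix t assume "t \<in> S"
    then show "M t = frac (t + (\<alpha> + x2 - x1))"
      using that \<open>t \<in> S\<close> by (cases rule: M_cases) (auto simp: seg_V_def)
  qed
  ultimately show ?thesis using squeeze_Y_bij[OF assms(6)] squeeze_Y_conj by blast
qed

end
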